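(* Let $0<q\le\frac15$ and $\sigma\ge 4$, and let $\omega=\omega_{q,\sigma}$ be the privacy loss density of the Poisson-subsampled Gaussian mechanism. Let $L$ be such that $\lambda=L/2$ satisfies $$1<\lambda\le \tfrac12\sigma^2 c-2\log\sigma,\qquad \lambda\le\frac{\frac12\sigma^2c-\log 5-2\log\sigma}{c+\log(q\lambda)+1/(2\sigma^2)},$$ where $c=\log\left(1+\frac{1}{q(\lambda-1)}\right)$. Then for every integer $k\ge1$, $$\int_L^\infty(\omega*^k\omega)(s)\,ds\le\left(1+\frac{2q^2(\tfrac L2+1)\tfrac L2}{\sigma^2}\right)^k e^{-L^2/2}.$$
   Context: For $0<q<1$ and $\sigma>0$, the privacy loss density of the Poisson-subsampled Gaussian mechanism (remove/add neighbouring relation) is the probability density $$\omega(s)=f(g(s))\,g'(s)\ \text{ if } s>\log(1-q),\qquad \omega(s)=0\ \text{ otherwise},$$ where $$f(t)=\frac{1}{\sqrt{2\pi\sigma^2}}\left[q\,e^{-(t-1)^2/(2\sigma^2)}+(1-q)\,e^{-t^2/(2\sigma^2)}\right],\qquad g(s)=\sigma^2\log\left(\frac{e^s-(1-q)}{q}\right)+\frac12 .$$ Equivalently, $\omega$ is the density of $\log\big(f(T)/f_Y(T)\big)$ where $T$ has density $f$ and $f_Y(t)=\frac{1}{\sqrt{2\pi\sigma^2}}e^{-t^2/(2\sigma^2)}$. The notation $\omega*^k\omega$ denotes the convolution of $k$ copies of $\omega$. *)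

theory Defs
  imports "HOL-Probability.Probability"
begin

definition sgm_density :: "real \<Rightarrow> real \<Rightarrow> real \<Rightarrow> real" where
  "sgm_density q \<sigma> t = q * normal_density 1 \<sigma> t + (1 - q) * normal_density 0 \<sigma> t"

lemma sgm_density_altdef:
  "sgm_density q \<sigma> t = 1 / sqrt (2 * pi * \<sigma>\<^sup>2) *
     (q * exp (- (t - 1)\<^sup>2 / (2 * \<sigma>\<^sup>2)) + (1 - q) * exp (- t\<^sup>2 / (2 * \<sigma>\<^sup>2)))"
  by (simp add: sgm_density_def normal_density_def distrib_left mult.left_commute)

definition loss_inv :: "real \<Rightarrow> real \<Rightarrow> real \<Rightarrow> real" where
  "loss_inv q \<sigma> s = \<sigma>\<^sup>2 * ln ((exp s - (1 - q)) / q) + 1 / 2"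

definition pld :: "real \<Rightarrow> real \<Rightarrow> real \<Rightarrow> real" where
  "pld q \<sigma> s =
     (if s > ln (1 - q) then sgm_density q \<sigma> (loss_inv q \<sigma> s) * deriv (loss_inv q \<sigma>) s else 0)"

text \<open>
  Convolution of non-negative functions, with values in the extended non-negative reals so that no
  integrability side condition is hidden in the integral. The formula is that of
  \<open>convolution_density\<close>.
\<close>

definition conv :: "(real \<Rightarrow> ennreal) \<Rightarrow> (real \<Rightarrow> ennreal) \<Rightarrow> real \<Rightarrow> ennreal" where
  "conv f g x = (\<integral>\<^sup>+ y. f (x - y) * g y \<partial>lborel)"

text \<open>
  The convolution of \<open>k\<close> copies of \<open>f\<close>, that is, \<open>k - 1\<close> convolutions; meaningful for \<open>k \<ge> 1\<close> only.
\<close>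

definition conv_power :: "(real \<Rightarrow> ennreal) \<Rightarrow> nat \<Rightarrow> real \<Rightarrow> ennreal" where
  "conv_power f k = (conv f ^^ (k - 1)) f"

lemma loss_inv_has_real_derivative:
  assumes "0 < q" "q < 1" "s > ln (1 - q)"
  shows "(loss_inv q \<sigma> has_real_derivative \<sigma>\<^sup>2 * exp s / (exp s - (1 - q))) (at s)"
proof -
  have pos: "exp s - (1 - q) > 0"
    using assms by (metis diff_gt_0_iff_gt exp_less_mono exp_ln)
  show ?thesis
    unfolding loss_inv_def[abs_def]
    by (rule derivative_eq_intros refl | use pos assms in \<open>simp add: field_simps\<close>)+
qed

lemma loss_loss_inv:
  assumes "0 < q" "q < 1" "0 < \<sigma>" "s > ln (1 - q)"
  shows "ln (sgm_density q \<sigma> (loss_inv q \<sigma> s) / normal_density 0 \<sigma> (loss_inv q \<sigma> s)) = s"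
proof -
  define t where "t = loss_inv q \<sigma> s"
  have pos: "exp s - (1 - q) > 0"
    using assms by (metis diff_gt_0_iff_gt exp_less_mono exp_ln)
  have "normal_density 1 \<sigma> t / normal_density 0 \<sigma> t
      = exp (- (t - 1)\<^sup>2 / (2 * \<sigma>\<^sup>2) - (- t\<^sup>2 / (2 * \<sigma>\<^sup>2)))"
    using assms by (simp add: normal_density_def flip: exp_diff)
  also have "- (t - 1)\<^sup>2 / (2 * \<sigma>\<^sup>2) - (- t\<^sup>2 / (2 * \<sigma>\<^sup>2)) = (t - 1 / 2) / \<sigma>\<^sup>2"
    using assms by (simp add: field_simps power2_eq_square)
  also have "\<dots> = ln ((exp s - (1 - q)) / q)"
    using assms by (simp add: t_def loss_inv_def)
  also have "exp \<dots> = (exp s - (1 - q)) / q"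
    using pos assms by simp
  finally have r: "normal_density 1 \<sigma> t / normal_density 0 \<sigma> t = (exp s - (1 - q)) / q" .
  have "sgm_density q \<sigma> t / normal_density 0 \<sigma> t
      = q * (normal_density 1 \<sigma> t / normal_density 0 \<sigma> t) + (1 - q)"
    using normal_density_pos[of \<sigma> 0 t] assms by (simp add: sgm_density_def add_divide_distrib)
  also have "\<dots> = exp s"
    unfolding r using assms by simp
  finally show ?thesis
    by (simp add: t_def)
qed

lemma pld_nonneg:
  assumes "0 < q" "q < 1"
  shows "pld q \<sigma> s \<ge> 0"
proof (cases "s > ln (1 - q)")
  case True
  then have "exp s - (1 - q) > 0"
    using assms by (metis diff_gt_0_iff_gt exp_less_mono exp_ln)
  moreover have "deriv (loss_inv q \<sigma>) s = \<sigma>\<^sup>2 * exp s / (exp s - (1 - q))"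
    using loss_inv_has_real_derivative[OF assms True] by (rule DERIV_imp_deriv)
  ultimately show ?thesis
    using assms by (simp add: pld_def sgm_density_def)
qed (simp add: pld_def)

end

theory Submission
  imports Defs
begin

text \<open>
  The Chernoff bound with exponent \<open>\<lambda> = L / 2\<close> reduces the claim to a bound on one moment: the
  substitution \<open>s = ln r(t)\<close>, with \<open>r = f / f\<^sub>Y\<close>, turns the exponential moment of \<open>\<omega>\<close> into
  \<open>E[r(Y)\<^sup>p]\<close>, where \<open>Y \<sim> N(0, \<sigma>\<^sup>2)\<close> and \<open>p = \<lambda> + 1\<close>. Here \<open>r = 1 + q W\<close> with \<open>W = exp u - 1\<close>,
  \<open>u = (Y - 1/2) / \<sigma>\<^sup>2\<close> and \<open>E[W] = 0\<close>, so by Taylor's formula it is enough that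
  \<open>E[W\<^sup>2 max(1, r\<^sup>m)] \<le> 4 / \<sigma>\<^sup>2\<close> with \<open>m = p - 2 = \<lambda> - 1\<close>. For \<open>u \<ge> 0\<close>, \<open>c\<close> is the point where
  \<open>r = 1 + 1 / m\<close>, and \<open>ln r\<close> grows at most at unit rate after it, so
  \<open>m ln r \<le> 1 + m max(0, u - c) \<le> 1 + m u\<^sup>2 / (4 c) \<le> 1 + \<sigma>\<^sup>2 u\<^sup>2 / 8\<close>, which the Gaussian density
  \<open>exp (- \<sigma>\<^sup>2 u\<^sup>2 / 2)\<close> absorbs at the price of a wider Gaussian.
\<close>

section \<open>Elementary inequalities for hyperbolic functions, exponentials and powers\<close>

lemma sinh_le_mult_cosh:
  fixes y :: real
  assumes "0 \<le> y"
  shows "sinh y \<le> y * cosh y"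
proof -
  have "0 * cosh 0 - sinh 0 \<le> y * cosh y - sinh y"
    by (rule DERIV_nonneg_imp_nondecreasing[OF assms])
       (intro exI conjI, (rule derivative_eq_intros refl)+, auto)
  then show ?thesis by simp
qed

text \<open>The derivative of \<open>cosh y * exp (- (y\<^sup>2 / 2))\<close> has the sign of
  \<open>sinh y - y * cosh y\<close>, so this product does not increase from its value 1 at
  0.\<close>

lemma cosh_le_exp_half_square:
  fixes y :: real
  assumes "0 \<le> y"
  shows "cosh y \<le> exp (y\<^sup>2 / 2)"
proof -
  have "cosh y * exp (- (y\<^sup>2 / 2)) \<le> cosh 0 * exp (- (0\<^sup>2 / 2))"
  proof (rule DERIV_nonpos_imp_nonincreasing[OF assms])
    fix x :: real assume "0 \<le> x" "x \<le> y"
    have "((\<lambda>x. cosh x * exp (- (x\<^sup>2 / 2))) has_real_derivative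
        (sinh x - x * cosh x) * exp (- (x\<^sup>2 / 2))) (at x)"
      by (rule derivative_eq_intros refl | simp add: algebra_simps)+
    moreover have "(sinh x - x * cosh x) * exp (- (x\<^sup>2 / 2)) \<le> 0"
      using sinh_le_mult_cosh[OF \<open>0 \<le> x\<close>] by (simp add: mult_nonpos_nonneg)
    ultimately show "\<exists>d. ((\<lambda>x. cosh x * exp (- (x\<^sup>2 / 2))) has_real_derivative d) (at x) \<and> d \<le> 0"
      by blast
  qed
  then show ?thesis
    by (simp add: exp_minus field_simps)
qed

text \<open>Factor \<open>exp u - 1\<close> as \<open>2 * exp (u / 2) * sinh (u / 2)\<close> and
  bound \<open>sinh\<close> through \<open>cosh\<close>. The linear exponent \<open>u\<close> keeps
  its sign, so one estimate serves both signs of \<open>u\<close>.\<close>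

lemma exp_minus_one_square_le:
  fixes u :: real
  shows "(exp u - 1)\<^sup>2 \<le> u\<^sup>2 * exp (u + u\<^sup>2 / 4)"
proof -
  define y where "y = \<bar>u\<bar> / 2"
  have y: "0 \<le> y" "y\<^sup>2 = u\<^sup>2 / 4"
    by (auto simp: y_def power2_eq_square)
  have "(exp u - 1)\<^sup>2 = exp u * (2 * sinh (u / 2))\<^sup>2"
  proof -
    have "exp u = exp (u / 2) * exp (u / 2)"
      by (simp flip: exp_add)
    then show ?thesis
      by (simp add: sinh_field_def exp_minus power2_eq_square field_simps)
  qed
  also have "(2 * sinh (u / 2))\<^sup>2 = (2 * sinh y)\<^sup>2"
    by (cases "u \<ge> 0") (auto simp: y_def sinh_minus)
  also have "\<dots> \<le> (2 * (y * exp (y\<^sup>2 / 2)))\<^sup>2"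
    using y sinh_le_mult_cosh[OF y(1)] mult_left_mono[OF cosh_le_exp_half_square[OF y(1)] y(1)]
    by (intro power_mono mult_left_mono) auto
  also have "\<dots> = u\<^sup>2 * exp (u\<^sup>2 / 4)"
  proof -
    have "u\<^sup>2 = 4 * y\<^sup>2"
      using y(2) by simp
    then show ?thesis
      by (simp add: power_mult_distrib flip: exp_double)
  qed
  finally show ?thesis
    by (simp add: exp_add mult_ac)
qed

text \<open>Taylor's formula at 0 with Lagrange remainder. As \<open>p \<ge> 2\<close>, the
  remainder factor \<open>(1 + t) powr (p - 2)\<close> increases in \<open>t\<close>, so over the
  segment between 0 and \<open>x\<close> it is largest at one of the two ends; hence the
  \<open>max\<close>.\<close>

lemma one_plus_powr_le_quadratic:
  fixes x p :: real
  assumes "x > - 1" and "p \<ge> 2"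
  shows "(1 + x) powr p \<le> 1 + p * x + p * (p - 1) / 2 * (x\<^sup>2 * max 1 ((1 + x) powr (p - 2)))"
proof (cases "x = 0")
  case False
  \<comment> \<open>The expansion stops at order 2, so the last branch is read at
    \<open>m = 2\<close> only.\<close>
  define diff :: "nat \<Rightarrow> real \<Rightarrow> real" where
    "diff = (\<lambda>m t. if m = 0 then (1 + t) powr p else if m = 1 then p * (1 + t) powr (p - 1)
      else p * (p - 1) * (1 + t) powr (p - 2))"
  have "\<exists>t. (if x < 0 then x < t \<and> t < 0 else 0 < t \<and> t < x) \<and>
      (1 + x) powr p = (\<Sum>m<2. diff m 0 / fact m * (x - 0) ^ m) + diff 2 t / fact 2 * (x - 0)\<^sup>2"
  proof (rule Taylor[where a = "min 0 x" and b = "max 0 x"])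
    show "\<forall>m t. m < 2 \<and> min 0 x \<le> t \<and> t \<le> max 0 x \<longrightarrow>
        (diff m has_real_derivative diff (Suc m) t) (at t)"
    proof (intro allI impI, elim conjE)
      fix m :: nat and t :: real
      assume "m < 2" and t: "min 0 x \<le> t" "t \<le> max 0 x"
      have "1 + t > 0" using t(1) assms(1) by linarith
      moreover have "m = 0 \<or> m = 1" using \<open>m < 2\<close> by auto
      ultimately show "(diff m has_real_derivative diff (Suc m) t) (at t)"
        by (auto simp: diff_def intro!: derivative_eq_intros)
    qed
  qed (use False in \<open>auto simp: diff_def\<close>)
  then obtain t where t: "if x < 0 then x < t \<and> t < 0 else 0 < t \<and> t < x"
    and eq: "(1 + x) powr p = 1 + p * x + p * (p - 1) / 2 * (x\<^sup>2 * (1 + t) powr (p - 2))"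
    by (auto simp: diff_def numeral_2_eq_2 mult_ac)
  have "(1 + t) powr (p - 2) \<le> max 1 ((1 + x) powr (p - 2))"
  proof (cases "x < 0")
    case True
    then have "(1 + t) powr (p - 2) \<le> 1 powr (p - 2)"
      using t assms by (intro powr_mono2) auto
    then show ?thesis by simp
  next
    case False
    then have "(1 + t) powr (p - 2) \<le> (1 + x) powr (p - 2)"
      using t assms by (intro powr_mono2) auto
    then show ?thesis by simp
  qed
  then show ?thesis
    unfolding eq using assms by (intro add_left_mono mult_left_mono) auto
qed simp

text \<open>At \<open>u = c\<close> the mixture equals \<open>1 + 1 / m\<close>, whose logarithm is
  at most \<open>1 / m\<close>. Beyond \<open>c\<close> it grows by at most the factor
  \<open>exp (u - c)\<close>, since its constant part \<open>1 - q\<close> is non-negative.\<close>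

lemma mixture_powr_le:
  fixes q m c u :: real
  assumes "0 < q" "q \<le> 1" "0 < m" "c = ln (1 + 1 / (q * m))" "0 \<le> u"
  shows "(1 - q + q * exp u) powr m \<le> exp (1 + m * (u\<^sup>2 / (4 * c)))"
proof -
  have "1 < 1 + 1 / (q * m)"
    using assms by simp
  then have c: "c > 0" and exp_c: "exp c = 1 + 1 / (q * m)"
    using assms(4) by (simp_all only: ln_gt_zero exp_ln_iff)
  have "exp c * q + 1 - q = 1 + 1 / m"
    using assms(1,3) unfolding exp_c by (simp add: field_simps)
  then have at_c: "ln (exp c * q + 1 - q) \<le> 1 / m"
    using assms(3) ln_add_one_self_le_self[of "1 / m"] by (simp only:) simp
  \<comment> \<open>The line \<open>u - c\<close> is tangent to this parabola at
    \<open>u = 2 * c\<close>.\<close>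
  have tangent: "u - c \<le> u\<^sup>2 / (4 * c)"
  proof -
    have "0 \<le> (u - 2 * c)\<^sup>2" by simp
    then show ?thesis using c by (simp add: field_simps power2_eq_square)
  qed
  have r: "1 - q + q * exp u > 0"
    using assms by (intro add_nonneg_pos) auto
  have rc: "exp c * q + 1 - q > 0"
    using assms by (simp add: add_pos_nonneg add_diff_eq[symmetric])
  have "ln (1 - q + q * exp u) \<le> 1 / m + u\<^sup>2 / (4 * c)"
  proof (cases "u \<le> c")
    case True
    then have "1 - q + q * exp u \<le> exp c * q + 1 - q"
      using assms by (simp add: mult_ac)
    then have "ln (1 - q + q * exp u) \<le> ln (exp c * q + 1 - q)"
      using r rc by simp
    moreover have "0 \<le> u\<^sup>2 / (4 * c)" using c by simp
    ultimately show ?thesis using at_c by linarith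
  next
    case False
    then have "1 \<le> exp (u - c)" by simp
    then have "(1 - q) * 1 \<le> (1 - q) * exp (u - c)"
      using assms by (intro mult_left_mono) auto
    then have "1 - q + q * exp u \<le> exp (u - c) * (exp c * q + 1 - q)"
      by (simp add: algebra_simps flip: exp_add)
    then have "ln (1 - q + q * exp u) \<le> ln (exp (u - c) * (exp c * q + 1 - q))"
      using r rc by (subst ln_le_cancel_iff) auto
    also have "\<dots> = u - c + ln (exp c * q + 1 - q)"
      using rc by (simp add: ln_mult)
    finally show ?thesis using at_c tangent by linarith
  qed
  then have "m * ln (1 - q + q * exp u) \<le> 1 + m * (u\<^sup>2 / (4 * c))"
    using mult_left_mono[of _ _ m] assms by (fastforce simp: distrib_left)
  then show ?thesis
    using r by (simp add: powr_def)
qed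

text \<open>The eighth power reduces the claim to a bound on \<open>exp 1\<close>. The value 3.096
  is the largest that still gives the constant 4 in the integral of the majorant: (3.096 + 1) / 2 *
  25/16 * 5/4 = 4.\<close>

lemma exp_nine_eighths_le: "exp (9 / 8 :: real) \<le> 3096 / 1000"
proof (rule power_le_imp_le_base)
  have "exp (9 / 8 :: real) ^ Suc 7 = exp 1 ^ 9"
    by (simp flip: exp_of_nat_mult)
  also have "\<dots> \<le> (272 / 100) ^ 9"
    using e_less_272 by (intro power_mono) auto
  also have "\<dots> \<le> (3096 / 1000 :: real) ^ Suc 7"
    by (simp add: power_numeral_reduce)
  finally show "exp (9 / 8 :: real) ^ Suc 7 \<le> (3096 / 1000) ^ Suc 7" .
qed auto

section \<open>Exponential moments of convolution powers and the Chernoff bound\<close>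

lemma borel_measurable_conv [measurable]:
  assumes [measurable]: "f \<in> borel_measurable borel" "g \<in> borel_measurable borel"
  shows "conv f g \<in> borel_measurable borel"
  unfolding conv_def[abs_def] by measurable

text \<open>Tonelli, then the translation \<open>s \<mapsto> s + y\<close> in the inner integral,
  which splits the exponential into a product. Values in \<open>ennreal\<close> make finiteness of
  the moments irrelevant.\<close>

lemma nn_integral_conv_exp:
  fixes f g :: "real \<Rightarrow> ennreal" and a :: real
  assumes [measurable]: "f \<in> borel_measurable borel" "g \<in> borel_measurable borel"
  shows "(\<integral>\<^sup>+ s. conv f g s * ennreal (exp (a * s)) \<partial>lborel)
    = (\<integral>\<^sup>+ s. f s * ennreal (exp (a * s)) \<partial>lborel) * (\<integral>\<^sup>+ s. g s * ennreal (exp (a * s)) \<partial>lborel)"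
proof -
  have "(\<integral>\<^sup>+ s. conv f g s * ennreal (exp (a * s)) \<partial>lborel)
      = (\<integral>\<^sup>+ s. \<integral>\<^sup>+ y. f (s - y) * g y * ennreal (exp (a * s)) \<partial>lborel \<partial>lborel)"
    unfolding conv_def by (simp add: nn_integral_multc)
  also have "\<dots> = (\<integral>\<^sup>+ y. \<integral>\<^sup>+ s. f (s - y) * g y * ennreal (exp (a * s)) \<partial>lborel \<partial>lborel)"
    by (rule lborel_pair.Fubini') measurable
  also have "\<dots> = (\<integral>\<^sup>+ y. (\<integral>\<^sup>+ s. f s * ennreal (exp (a * s)) \<partial>lborel) * (g y * ennreal (exp (a * y))) \<partial>lborel)"
  proof (rule nn_integral_cong)
    fix y :: real
    have "(\<integral>\<^sup>+ s. f (s - y) * g y * ennreal (exp (a * s)) \<partial>lborel)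
        = (\<integral>\<^sup>+ s. f s * g y * ennreal (exp (a * (s + y))) \<partial>lborel)"
      by (subst nn_integral_real_affine[where c = 1 and t = y]) (simp_all add: add.commute)
    also have "\<dots> = (\<integral>\<^sup>+ s. (f s * ennreal (exp (a * s))) * (g y * ennreal (exp (a * y))) \<partial>lborel)"
      by (simp add: distrib_left exp_add ennreal_mult mult_ac)
    also have "\<dots> = (\<integral>\<^sup>+ s. f s * ennreal (exp (a * s)) \<partial>lborel) * (g y * ennreal (exp (a * y)))"
      by (rule nn_integral_multc) measurable
    finally show "(\<integral>\<^sup>+ s. f (s - y) * g y * ennreal (exp (a * s)) \<partial>lborel) = \<dots>" .
  qed
  also have "\<dots> = (\<integral>\<^sup>+ s. f s * ennreal (exp (a * s)) \<partial>lborel) * (\<integral>\<^sup>+ s. g s * ennreal (exp (a * s)) \<partial>lborel)"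
    by (rule nn_integral_cmult) measurable
  finally show ?thesis .
qed

text \<open>The subtraction in \<open>conv_power\<close> is truncated, so the powers 0 and 1 are
  both \<open>f\<close>, and the recursion starts at 1.\<close>

lemma conv_power_Suc: "k \<ge> 1 \<Longrightarrow> conv_power f (Suc k) = conv f (conv_power f k)"
  by (cases k) (auto simp: conv_power_def)

lemma borel_measurable_conv_power [measurable]:
  assumes [measurable]: "f \<in> borel_measurable borel"
  shows "conv_power f k \<in> borel_measurable borel"
proof (cases k)
  case (Suc n)
  have "(conv f ^^ n) f \<in> borel_measurable borel"
    by (induction n) auto
  then show ?thesis by (simp add: Suc conv_power_def)
qed (simp add: conv_power_def)

lemma nn_integral_conv_power_exp:
  fixes f :: "real \<Rightarrow> ennreal" and a :: real
  assumes f [measurable]: "f \<in> borel_measurable borel" and "k \<ge> 1"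
  shows "(\<integral>\<^sup>+ s. conv_power f k s * ennreal (exp (a * s)) \<partial>lborel)
    = (\<integral>\<^sup>+ s. f s * ennreal (exp (a * s)) \<partial>lborel) ^ k"
  using \<open>k \<ge> 1\<close>
proof (induction k rule: dec_induct)
  case base
  then show ?case by (simp add: conv_power_def)
next
  case (step n)
  then show ?case by (simp add: conv_power_Suc nn_integral_conv_exp)
qed

text \<open>The indicator of \<open>{L..}\<close> is at most \<open>exp (a * (s - L))\<close> for
  \<open>a \<ge> 0\<close>.\<close>

lemma nn_integral_chernoff:
  fixes h :: "real \<Rightarrow> ennreal" and a L :: real
  assumes [measurable]: "h \<in> borel_measurable borel" and "0 \<le> a"
  shows "(\<integral>\<^sup>+ s \<in> {L..}. h s \<partial>lborel)
    \<le> (\<integral>\<^sup>+ s. h s * ennreal (exp (a * s)) \<partial>lborel) * ennreal (exp (- (a * L)))"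
proof -
  have "(\<integral>\<^sup>+ s \<in> {L..}. h s \<partial>lborel)
      \<le> (\<integral>\<^sup>+ s. h s * ennreal (exp (a * s)) * ennreal (exp (- (a * L))) \<partial>lborel)"
  proof (rule nn_integral_mono)
    fix s :: real
    have "1 \<le> exp (a * s) * exp (- (a * L))" if "L \<le> s"
      using that assms by (simp add: mult_left_mono flip: exp_add)
    then have "indicator {L..} s \<le> ennreal (exp (a * s) * exp (- (a * L)))"
      by (auto simp: indicator_def)
    then have "h s * indicator {L..} s \<le> h s * ennreal (exp (a * s) * exp (- (a * L)))"
      by (rule mult_left_mono) simp
    then show "h s * indicator {L..} s \<le> h s * ennreal (exp (a * s)) * ennreal (exp (- (a * L)))"
      by (simp add: ennreal_mult mult.assoc)
  qed
  also have "\<dots> = (\<integral>\<^sup>+ s. h s * ennreal (exp (a * s)) \<partial>lborel) * ennreal (exp (- (a * L)))"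
    by (rule nn_integral_multc) measurable
  finally show ?thesis .
qed

section \<open>Change of variables from the loss to the Gaussian variable\<close>

text \<open>Substitution on compact intervals, each contributing an integral over part of the line,
  followed by a monotone limit. An inequality suffices for an upper bound and spares the study of
  the range of \<open>g\<close>.\<close>

lemma nn_integral_substitution_greaterThan_le:
  fixes f :: "real \<Rightarrow> ennreal" and g g' :: "real \<Rightarrow> real"
  assumes f [measurable]: "f \<in> borel_measurable borel"
    and der: "\<And>x. x > a \<Longrightarrow> (g has_real_derivative g' x) (at x)"
    and cont: "continuous_on {a<..} g'"
    and nonneg: "\<And>x. x > a \<Longrightarrow> g' x \<ge> 0"
  shows "(\<integral>\<^sup>+ x \<in> {a<..}. f (g x) * ennreal (g' x) \<partial>lborel) \<le> (\<integral>\<^sup>+ x. f x \<partial>lborel)"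
proof -
  \<comment> \<open>These intervals stay away from \<open>a\<close>, where \<open>g\<close> may be
    unbounded, as \<open>loss_inv\<close> is at \<open>ln (1 - q)\<close>.\<close>
  define J :: "nat \<Rightarrow> real set" where "J n = {a + 1 / real (Suc n)..a + 1 + real (Suc n)}" for n
  define h where "h x = f (g x) * ennreal (g' x) * indicator {a<..} x" for x
  have J_less: "a + 1 / real (Suc n) < a + 1 + real (Suc n)" for n
    by (simp add: field_simps) (smt (verit) of_nat_0_le_iff mult_nonneg_nonneg)
  have J_sub: "J n \<subseteq> {a<..}" for n
    by (auto simp: J_def) (smt (verit) of_nat_0_le_iff divide_pos_pos)
  have J_incseq: "incseq J"
  proof (rule incseq_SucI)
    fix n
    have "1 / real (Suc (Suc n)) \<le> 1 / real (Suc n)"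
      by (intro divide_left_mono) auto
    then show "J n \<subseteq> J (Suc n)" by (auto simp: J_def)
  qed
  have J_UN: "(\<Union>n. J n) = {a<..}"
  proof
    show "{a<..} \<subseteq> (\<Union>n. J n)"
    proof
      fix x assume "x \<in> {a<..}"
      then obtain n where n: "inverse (real (Suc n)) < x - a"
        using reals_Archimedean[of "x - a"] by auto
      obtain m where m: "x - a \<le> real m"
        using real_arch_simple by blast
      have "inverse (real (Suc (max n m))) \<le> inverse (real (Suc n))"
        by (intro le_imp_inverse_le) auto
      then have "a + 1 / real (Suc (max n m)) \<le> x"
        using n by (simp add: inverse_eq_divide)
      moreover have "x \<le> a + 1 + real (Suc (max n m))"
        using m by simp
      ultimately show "x \<in> (\<Union>n. J n)" by (auto simp: J_def)
    qed
  qed (use J_sub in auto)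
  have h_meas [measurable]: "h \<in> borel_measurable borel"
  proof -
    \<comment> \<open>Nothing is assumed of \<open>g\<close> and \<open>g'\<close> outside
      \<open>{a<..}\<close>, so measurability of \<open>h\<close> goes through their extensions by
      0.\<close>
    have "continuous_on {a<..} g"
      using der by (meson DERIV_continuous continuous_at_imp_continuous_on greaterThan_iff)
    then have [measurable]: "(\<lambda>x. indicator {a<..} x *\<^sub>R g x) \<in> borel_measurable borel"
      by (intro borel_measurable_continuous_on_indicator) auto
    have [measurable]: "(\<lambda>x. indicator {a<..} x *\<^sub>R g' x) \<in> borel_measurable borel"
      using cont by (intro borel_measurable_continuous_on_indicator) auto
    have "h = (\<lambda>x. f (indicator {a<..} x *\<^sub>R g x) * ennreal (indicator {a<..} x *\<^sub>R g' x)
        * indicator {a<..} x)"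
      by (auto simp: h_def fun_eq_iff indicator_def)
    also have "\<dots> \<in> borel_measurable borel"
      by measurable
    finally show ?thesis .
  qed
  have le: "emeasure (density lborel h) (J n) \<le> (\<integral>\<^sup>+ x. f x \<partial>lborel)" for n
  proof -
    let ?l = "a + 1 / real (Suc n)" and ?r = "a + 1 + real (Suc n)"
    have gt: "x > a" if "x \<in> {?l..?r}" for x
      using J_sub[of n] that by (auto simp: J_def)
    have "emeasure (density lborel h) (J n) = (\<integral>\<^sup>+ x. f (g x) * g' x * indicator {?l..?r} x \<partial>lborel)"
      using gt by (subst emeasure_density)
        (auto simp: J_def h_def indicator_def intro!: nn_integral_cong)
    also have "\<dots> = (\<integral>\<^sup>+ x. f x * indicator {g ?l..g ?r} x \<partial>lborel)"
      using J_less[of n] der nonneg gt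
      by (intro nn_integral_substitution_aux[symmetric] continuous_on_subset[OF cont]) auto
    also have "\<dots> \<le> (\<integral>\<^sup>+ x. f x \<partial>lborel)"
      by (intro nn_integral_mono) (auto simp: indicator_def)
    finally show ?thesis .
  qed
  \<comment> \<open>With \<open>h\<close> as a density, the exhaustion becomes continuity from below
    of a measure.\<close>
  have "(\<integral>\<^sup>+ x \<in> {a<..}. f (g x) * ennreal (g' x) \<partial>lborel) = emeasure (density lborel h) (\<Union>n. J n)"
    unfolding J_UN by (subst emeasure_density) (auto simp: h_def indicator_def intro!: nn_integral_cong)
  also have "\<dots> = (SUP n. emeasure (density lborel h) (J n))"
  proof (rule SUP_emeasure_incseq[symmetric])
    show "range J \<subseteq> sets (density lborel h)" by (auto simp: J_def)
  qed (fact J_incseq)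
  also have "\<dots> \<le> (\<integral>\<^sup>+ x. f x \<partial>lborel)"
    using le by (intro SUP_least)
  finally show ?thesis .
qed

text \<open>The ratio \<open>r\<close> of \<open>sgm_density q \<sigma>\<close> to
  \<open>normal_density 0 \<sigma>\<close>, with the common Gaussian factor cancelled.\<close>

definition loss_ratio :: "real \<Rightarrow> real \<Rightarrow> real \<Rightarrow> real" where
  "loss_ratio q \<sigma> t = 1 - q + q * exp ((t - 1 / 2) / \<sigma>\<^sup>2)"

lemma borel_measurable_loss_ratio [measurable]: "loss_ratio q \<sigma> \<in> borel_measurable borel"
  unfolding loss_ratio_def[abs_def] by measurable

lemma loss_ratio_pos:
  assumes "0 < q" "q \<le> 1"
  shows "loss_ratio q \<sigma> t > 0"
  using assms by (simp add: loss_ratio_def add_nonneg_pos)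

lemma normal_density_one_eq:
  assumes "\<sigma> \<noteq> 0"
  shows "normal_density 1 \<sigma> t = normal_density 0 \<sigma> t * exp ((t - 1 / 2) / \<sigma>\<^sup>2)"
proof -
  have "- (t - 1)\<^sup>2 / (2 * \<sigma>\<^sup>2) = - (t - 0)\<^sup>2 / (2 * \<sigma>\<^sup>2) + (t - 1 / 2) / \<sigma>\<^sup>2"
    using assms by (simp add: field_simps power2_eq_square)
  then show ?thesis
    by (simp only: normal_density_def exp_add mult.assoc)
qed

lemma sgm_density_eq_loss_ratio:
  assumes "\<sigma> \<noteq> 0"
  shows "sgm_density q \<sigma> t = normal_density 0 \<sigma> t * loss_ratio q \<sigma> t"
  using assms by (simp add: sgm_density_def loss_ratio_def normal_density_one_eq algebra_simps)

lemma exp_gt_of_gt_ln: "0 < a \<Longrightarrow> ln a < s \<Longrightarrow> a < exp (s::real)"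
  by (metis exp_less_mono exp_ln)

lemma loss_ratio_loss_inv:
  assumes "0 < q" "q < 1" "\<sigma> \<noteq> 0" "s > ln (1 - q)"
  shows "loss_ratio q \<sigma> (loss_inv q \<sigma> s) = exp s"
  using assms exp_gt_of_gt_ln[of "1 - q" s] by (simp add: loss_ratio_def loss_inv_def)

lemma pld_eq:
  assumes "0 < q" "q < 1" "s > ln (1 - q)"
  shows "pld q \<sigma> s = sgm_density q \<sigma> (loss_inv q \<sigma> s) * (\<sigma>\<^sup>2 * exp s / (exp s - (1 - q)))"
  using DERIV_imp_deriv[OF loss_inv_has_real_derivative[OF assms]] assms by (simp add: pld_def)

lemma borel_measurable_pld:
  assumes "0 < q" "q < 1"
  shows "pld q \<sigma> \<in> borel_measurable borel"
proof -
  have "pld q \<sigma> = (\<lambda>s. if s > ln (1 - q)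
      then sgm_density q \<sigma> (loss_inv q \<sigma> s) * (\<sigma>\<^sup>2 * exp s / (exp s - (1 - q))) else 0)"
    using pld_eq[OF assms] by (auto simp: pld_def fun_eq_iff)
  also have "\<dots> \<in> borel_measurable borel"
    unfolding sgm_density_def loss_inv_def by measurable
  finally show ?thesis .
qed

text \<open>At \<open>t = loss_inv q \<sigma> s\<close> the ratio is \<open>exp s\<close>, so
  \<open>exp (a * s)\<close> supplies its power \<open>a\<close>; the remaining factor is the one by
  which \<open>sgm_density\<close> differs from the centred Gaussian.\<close>

lemma nn_integral_pld_exp_le:
  assumes "0 < q" "q < 1" "\<sigma> \<noteq> 0"
  shows "(\<integral>\<^sup>+ s. ennreal (pld q \<sigma> s) * ennreal (exp (a * s)) \<partial>lborel)
    \<le> (\<integral>\<^sup>+ t. ennreal (normal_density 0 \<sigma> t * loss_ratio q \<sigma> t powr (a + 1)) \<partial>lborel)"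
proof -
  define f where "f t = ennreal (normal_density 0 \<sigma> t * loss_ratio q \<sigma> t powr (a + 1))" for t
  define g' where "g' s = \<sigma>\<^sup>2 * exp s / (exp s - (1 - q))" for s
  have pos: "exp s - (1 - q) > 0" if "s > ln (1 - q)" for s
    using exp_gt_of_gt_ln[of "1 - q" s] that assms by simp
  have "ennreal (pld q \<sigma> s) * ennreal (exp (a * s))
      = f (loss_inv q \<sigma> s) * ennreal (g' s) * indicator {ln (1 - q)<..} s" for s
  proof (cases "s > ln (1 - q)")
    case True
    have "g' s \<ge> 0" using pos[OF True] by (simp add: g'_def)
    moreover have "exp s powr (a + 1) = exp s * exp (a * s)"
      by (simp add: powr_def algebra_simps flip: exp_add)
    then have "pld q \<sigma> s * exp (a * s)
        = normal_density 0 \<sigma> (loss_inv q \<sigma> s) * loss_ratio q \<sigma> (loss_inv q \<sigma> s) powr (a + 1) * g' s"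
      unfolding g'_def using True assms
      by (simp add: pld_eq sgm_density_eq_loss_ratio loss_ratio_loss_inv)
    ultimately show ?thesis
      using True assms pld_nonneg[of q \<sigma> s] by (simp add: f_def flip: ennreal_mult)
  qed (simp add: pld_def)
  then have "(\<integral>\<^sup>+ s. ennreal (pld q \<sigma> s) * ennreal (exp (a * s)) \<partial>lborel)
      = (\<integral>\<^sup>+ s \<in> {ln (1 - q)<..}. f (loss_inv q \<sigma> s) * ennreal (g' s) \<partial>lborel)"
    by simp
  also have "\<dots> \<le> (\<integral>\<^sup>+ t. f t \<partial>lborel)"
  proof (rule nn_integral_substitution_greaterThan_le)
    show "f \<in> borel_measurable borel"
      unfolding f_def[abs_def] by measurable
    show "(loss_inv q \<sigma> has_real_derivative g' s) (at s)" if "s > ln (1 - q)" for s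
      unfolding g'_def using assms that by (intro loss_inv_has_real_derivative)
    show "continuous_on {ln (1 - q)<..} g'"
      unfolding g'_def[abs_def] using pos by (intro continuous_intros) force
    show "g' s \<ge> 0" if "s > ln (1 - q)" for s
      using pos[OF that] by (simp add: g'_def)
  qed
  finally show ?thesis
    by (simp add: f_def)
qed

section \<open>A Gaussian majorant for the second-order term\<close>

lemma normal_density_zero_shift:
  assumes "\<sigma> \<noteq> 0" "u = (t - 1 / 2) / \<sigma>\<^sup>2"
  shows "normal_density 0 \<sigma> t
    = 1 / sqrt (2 * pi * \<sigma>\<^sup>2) * exp (- (\<sigma>\<^sup>2 * u\<^sup>2 / 2 + u / 2 + 1 / (8 * \<sigma>\<^sup>2)))"
proof -
  have "- (t - 0)\<^sup>2 / (2 * \<sigma>\<^sup>2) = - (\<sigma>\<^sup>2 * u\<^sup>2 / 2 + u / 2 + 1 / (8 * \<sigma>\<^sup>2))"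
  proof -
    have "t = \<sigma>\<^sup>2 * u + 1 / 2"
      using assms by simp
    then show ?thesis
      using assms(1) by (simp only:) (simp add: field_simps power2_eq_square)
  qed
  then show ?thesis
    by (simp only: normal_density_def)
qed

text \<open>Widening by 5/4 turns the exponent coefficient 1/2 into 8/25; the prefactor 5/4 restores
  the original normalisation.\<close>

lemma normal_density_wide_shift:
  assumes "0 < \<sigma>" "u = (t - 1 / 2) / \<sigma>\<^sup>2"
  shows "5 / 4 * normal_density (1 / 2) (5 / 4 * \<sigma>) t
    = 1 / sqrt (2 * pi * \<sigma>\<^sup>2) * exp (- (8 / 25 * (\<sigma>\<^sup>2 * u\<^sup>2)))"
proof -
  have e: "- (t - 1 / 2)\<^sup>2 / (2 * (5 / 4 * \<sigma>)\<^sup>2) = - (8 / 25 * (\<sigma>\<^sup>2 * u\<^sup>2))"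
  proof -
    have "t - 1 / 2 = \<sigma>\<^sup>2 * u"
      using assms by simp
    then show ?thesis
      using assms(1) by (simp only:) (simp add: field_simps power2_eq_square)
  qed
  have "sqrt (2 * pi * (5 / 4 * \<sigma>)\<^sup>2) = 5 / 4 * sqrt (2 * pi * \<sigma>\<^sup>2)"
    using assms by (simp add: real_sqrt_mult)
  then show ?thesis
    unfolding normal_density_def e by (simp only:) simp
qed

text \<open>
  The wider Gaussian has standard deviation \<open>5 \<sigma> / 4\<close>. It is reflected at \<open>t = 1/2\<close>, that is, at
  \<open>u = 0\<close>, and the factor \<open>exp (9/8)\<close>, needed on one side only, consists of \<open>e\<close> from
  \<open>r\<^sup>m \<le> exp (1 + \<sigma>\<^sup>2 u\<^sup>2 / 8)\<close> and \<open>exp (1/8)\<close> from \<open>u / 2 \<le> 1/8 + u\<^sup>2 / 2\<close>. Without halving this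
  factor by symmetry the constant \<open>4\<close> would be missed.
\<close>

definition second_order_majorant :: "real \<Rightarrow> real \<Rightarrow> real" where
  "second_order_majorant \<sigma> t = (if t \<ge> 1 / 2 then exp (9 / 8) else 1) *
     (5 / (4 * \<sigma> ^ 4) * (normal_density (1 / 2) (5 / 4 * \<sigma>) t * (t - 1 / 2)\<^sup>2))"

lemma second_order_le_majorant:
  fixes q \<sigma> m c t :: real
  assumes "0 < q" "q \<le> 1" "\<sigma> \<ge> 4" "0 < m" "c = ln (1 + 1 / (q * m))" "m \<le> \<sigma>\<^sup>2 * c / 2"
  shows "normal_density 0 \<sigma> t *
      ((exp ((t - 1 / 2) / \<sigma>\<^sup>2) - 1)\<^sup>2 * max 1 (loss_ratio q \<sigma> t powr m))
    \<le> second_order_majorant \<sigma> t"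
proof -
  define u where "u = (t - 1 / 2) / \<sigma>\<^sup>2"
  define C where "C = 1 / sqrt (2 * pi * \<sigma>\<^sup>2)"
  have C: "C \<ge> 0" by (simp add: C_def)
  have phi: "normal_density 0 \<sigma> t = C * exp (- (\<sigma>\<^sup>2 * u\<^sup>2 / 2 + u / 2 + 1 / (8 * \<sigma>\<^sup>2)))"
    using normal_density_zero_shift[OF _ u_def] assms by (simp add: C_def)
  have maj: "second_order_majorant \<sigma> t
      = (if u \<ge> 0 then exp (9 / 8) else 1) * (C * u\<^sup>2 * exp (- (8 / 25 * (\<sigma>\<^sup>2 * u\<^sup>2))))"
  proof -
    have "t \<ge> 1 / 2 \<longleftrightarrow> u \<ge> 0"
      using assms by (simp add: u_def zero_le_divide_iff)
    moreover have "5 / (4 * \<sigma> ^ 4) * (normal_density (1 / 2) (5 / 4 * \<sigma>) t * (t - 1 / 2)\<^sup>2)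
        = (5 / 4 * normal_density (1 / 2) (5 / 4 * \<sigma>) t) * u\<^sup>2"
      by (simp add: u_def power_divide)
    moreover have "5 / 4 * normal_density (1 / 2) (5 / 4 * \<sigma>) t = C * exp (- (8 / 25 * (\<sigma>\<^sup>2 * u\<^sup>2)))"
      using normal_density_wide_shift[OF _ u_def] assms by (simp add: C_def)
    ultimately show ?thesis
      unfolding second_order_majorant_def by (simp only:) (simp add: mult_ac)
  qed
  have "\<sigma>\<^sup>2 \<ge> 4\<^sup>2" using assms by (intro power_mono) auto
  then have su: "16 * u\<^sup>2 \<le> \<sigma>\<^sup>2 * u\<^sup>2"
    by (intro mult_right_mono) auto
  have sig: "1 / (8 * \<sigma>\<^sup>2) \<ge> 0" by simp
  \<comment> \<open>\<open>b\<close> bounds the logarithm of the \<open>max\<close>. For negative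
    \<open>u\<close> the ratio is at most 1, so 0 suffices there.\<close>
  define b where "b = (if u \<ge> 0 then 1 + \<sigma>\<^sup>2 * u\<^sup>2 / 8 else 0)"
  have "max 1 (loss_ratio q \<sigma> t powr m) \<le> exp b"
  proof (cases "u \<ge> 0")
    case True
    have "1 < 1 + 1 / (q * m)" using assms by simp
    then have c: "c > 0" using assms(5) by (simp only: ln_gt_zero)
    \<comment> \<open>The hypothesis on \<open>m\<close> enters here and cancels
      \<open>c\<close>.\<close>
    have "m * (u\<^sup>2 / (4 * c)) \<le> (\<sigma>\<^sup>2 * c / 2) * (u\<^sup>2 / (4 * c))"
      using assms c by (intro mult_right_mono) auto
    also have "\<dots> = \<sigma>\<^sup>2 * u\<^sup>2 / 8"
      using c by simp
    finally have "1 + m * (u\<^sup>2 / (4 * c)) \<le> b"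
      using True by (simp add: b_def)
    then have "loss_ratio q \<sigma> t powr m \<le> exp b"
      using mixture_powr_le[of q m c u] assms True exp_le_cancel_iff[of "1 + m * (u\<^sup>2 / (4 * c))" b]
      unfolding loss_ratio_def u_def[symmetric] by linarith
    moreover have "1 \<le> exp b" using True by (simp add: b_def)
    ultimately show ?thesis by simp
  next
    case False
    then have "q * exp u \<le> q * 1"
      using assms by (intro mult_left_mono) auto
    then have "loss_ratio q \<sigma> t \<le> 1"
      unfolding loss_ratio_def u_def[symmetric] by simp
    then have "loss_ratio q \<sigma> t powr m \<le> 1"
      using assms loss_ratio_pos[of q \<sigma> t] by (intro powr_le1) auto
    then show ?thesis using False by (simp add: b_def)
  qed
  then have "normal_density 0 \<sigma> t * ((exp u - 1)\<^sup>2 * max 1 (loss_ratio q \<sigma> t powr m))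
      \<le> normal_density 0 \<sigma> t * (u\<^sup>2 * exp (u + u\<^sup>2 / 4) * exp b)"
    using exp_minus_one_square_le[of u] by (intro mult_left_mono mult_mono) auto
  also have "\<dots> = C * u\<^sup>2 * exp (- (\<sigma>\<^sup>2 * u\<^sup>2 / 2 + u / 2 + 1 / (8 * \<sigma>\<^sup>2)) + (u + u\<^sup>2 / 4) + b)"
    unfolding phi exp_add by simp
  also have "\<dots> \<le> C * u\<^sup>2 * exp ((if u \<ge> 0 then 9 / 8 else 0) - 8 / 25 * (\<sigma>\<^sup>2 * u\<^sup>2))"
  proof -
    have "0 \<le> (u - 1 / 2)\<^sup>2" by simp
    then have "u / 2 \<le> 1 / 8 + u\<^sup>2 / 2"
      by (simp add: field_simps power2_eq_square)
    \<comment> \<open>For \<open>u \<ge> 0\<close> the terms in \<open>u\<^sup>2\<close> add up to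
      3/4, worth at most 3/64 of \<open>\<sigma>\<^sup>2 * u\<^sup>2\<close> because
      \<open>\<sigma> \<ge> 4\<close>. The total coefficient - 1/2 + 1/8 + 3/64 = - 21/64 is just
      below - 8/25, which is what fixes the width 5/4.\<close>
    then have "- (\<sigma>\<^sup>2 * u\<^sup>2 / 2 + u / 2 + 1 / (8 * \<sigma>\<^sup>2)) + (u + u\<^sup>2 / 4) + b
        \<le> (if u \<ge> 0 then 9 / 8 else 0) - 8 / 25 * (\<sigma>\<^sup>2 * u\<^sup>2)"
      using su sig zero_le_power2[of u] by (cases "u \<ge> 0"; simp only: b_def if_True if_False; linarith)
    then show ?thesis
      using C by (intro mult_left_mono) auto
  qed
  also have "\<dots> = second_order_majorant \<sigma> t"
    by (simp add: maj diff_conv_add_uminus exp_add mult_ac del: add_uminus_conv_diff)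
  finally show ?thesis
    by (simp add: u_def)
qed

text \<open>Averaging with the reflection \<open>t \<mapsto> 1 - t\<close> replaces the one-sided
  factor by \<open>(exp (9 / 8) + 1) / 2\<close>, and what remains is the variance of the wide
  Gaussian.\<close>

lemma second_order_majorant_bochner:
  assumes "0 < \<sigma>"
  shows "integrable lborel (second_order_majorant \<sigma>)"
    and "(\<integral> t. second_order_majorant \<sigma> t \<partial>lborel) \<le> 4 / \<sigma>\<^sup>2"
proof -
  define N where "N t = normal_density (1 / 2) (5 / 4 * \<sigma>) t * (t - 1 / 2)\<^sup>2" for t
  have "has_bochner_integral lborel N (fact (2 * 1) / ((2 / (5 / 4 * \<sigma>)\<^sup>2) ^ 1 * fact 1))"
    unfolding N_def using normal_moment_even[of "5 / 4 * \<sigma>" "1 / 2" 1] assms by simp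
  then have N: "has_bochner_integral lborel N (25 / 16 * \<sigma>\<^sup>2)"
    by (simp add: power2_eq_square)
  note N_int = integrable.intros[OF N]
  have [measurable]: "N \<in> borel_measurable borel"
    using N_int by auto
  define H where "H t = (if t \<ge> 1 / 2 then exp (9 / 8) else 1) * N t" for t :: real
  have H_int: "integrable lborel H"
  proof (rule Bochner_Integration.integrable_bound)
    show "integrable lborel (\<lambda>t. exp (9 / 8) * N t)"
      using N_int by simp
    show "H \<in> borel_measurable lborel"
      unfolding H_def by measurable
    show "AE t in lborel. norm (H t) \<le> norm (exp (9 / 8) * N t)"
    proof (rule AE_I2)
      fix t :: real
      have "N t \<ge> 0" by (simp add: N_def)
      moreover have "1 * N t \<le> exp (9 / 8) * N t"
        using \<open>N t \<ge> 0\<close> by (intro mult_right_mono) auto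
      ultimately show "norm (H t) \<le> norm (exp (9 / 8) * N t)"
        by (simp add: H_def)
    qed
  qed
  have "(\<integral> t. H t \<partial>lborel) = (\<integral> t. H (1 - t) \<partial>lborel)"
    using lborel_integral_real_affine[of "- 1" H 1] by simp
  moreover have "integrable lborel (\<lambda>t. H (1 - t))"
    using lborel_integrable_real_affine[OF H_int, of "- 1" 1] by simp
  ultimately have "2 * (\<integral> t. H t \<partial>lborel) = (\<integral> t. H t + H (1 - t) \<partial>lborel)"
    using H_int by simp
  also have "\<dots> = (\<integral> t. (exp (9 / 8) + 1) * N t \<partial>lborel)"
  proof (rule Bochner_Integration.integral_cong[OF refl])
    fix t :: real
    have "N (1 - t) = N t"
      by (simp add: N_def normal_density_def power2_commute[of "1 / 2" t])
    then show "H t + H (1 - t) = (exp (9 / 8) + 1) * N t"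
    \<comment> \<open>At the centre both summands carry \<open>exp (9 / 8)\<close>, but
      \<open>N\<close> vanishes there.\<close>
    proof (cases "t = 1 / 2")
      case True
      then have "N t = 0" by (simp add: N_def)
      then show ?thesis using \<open>N (1 - t) = N t\<close> by (simp add: H_def)
    next
      case False
      then show ?thesis using \<open>N (1 - t) = N t\<close> by (auto simp: H_def algebra_simps)
    qed
  qed
  also have "\<dots> = (exp (9 / 8) + 1) * (25 / 16 * \<sigma>\<^sup>2)"
    using has_bochner_integral_integral_eq[OF N] by simp
  also have "\<dots> \<le> (4096 / 1000) * (25 / 16 * \<sigma>\<^sup>2)"
    using exp_nine_eighths_le by (intro mult_right_mono) auto
  finally have H_le: "(\<integral> t. H t \<partial>lborel) \<le> 32 / 10 * \<sigma>\<^sup>2"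
    by simp
  have eq: "second_order_majorant \<sigma> = (\<lambda>t. 5 / (4 * \<sigma> ^ 4) * H t)"
    by (auto simp: second_order_majorant_def H_def N_def fun_eq_iff)
  show "integrable lborel (second_order_majorant \<sigma>)"
    unfolding eq using H_int by simp
  have "(\<integral> t. second_order_majorant \<sigma> t \<partial>lborel) = 5 / (4 * \<sigma> ^ 4) * (\<integral> t. H t \<partial>lborel)"
    unfolding eq by simp
  also have "\<dots> \<le> 5 / (4 * \<sigma> ^ 4) * (32 / 10 * \<sigma>\<^sup>2)"
    using H_le by (intro mult_left_mono) auto
  also have "\<dots> = 4 / \<sigma>\<^sup>2"
    using assms by (simp add: field_simps power2_eq_square power4_eq_xxxx)
  finally show "(\<integral> t. second_order_majorant \<sigma> t \<partial>lborel) \<le> 4 / \<sigma>\<^sup>2" .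
qed

section \<open>The moment bound and the tail estimate\<close>

lemma nn_integral_loss_ratio_powr_le:
  fixes q \<sigma> m c :: real
  assumes "0 < q" "q < 1" "\<sigma> \<ge> 4" "0 < m" "c = ln (1 + 1 / (q * m))" "m \<le> \<sigma>\<^sup>2 * c / 2"
  shows "(\<integral>\<^sup>+ t. ennreal (normal_density 0 \<sigma> t * loss_ratio q \<sigma> t powr (m + 2)) \<partial>lborel)
    \<le> ennreal (1 + 2 * q\<^sup>2 * (m + 2) * (m + 1) / \<sigma>\<^sup>2)"
proof -
  define K where "K = (m + 2) * (m + 1) / 2 * q\<^sup>2"
  have K: "K \<ge> 0" using assms by (simp add: K_def)
  \<comment> \<open>The first-order term is written as a difference of two probability densities, so
    its integral is visibly 0.\<close>
  define B where "B t = normal_density 0 \<sigma> t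
      + (m + 2) * q * (normal_density 1 \<sigma> t - normal_density 0 \<sigma> t) + K * second_order_majorant \<sigma> t" for t
  have pointwise: "normal_density 0 \<sigma> t * loss_ratio q \<sigma> t powr (m + 2) \<le> B t" for t
  proof -
    define W where "W = exp ((t - 1 / 2) / \<sigma>\<^sup>2) - 1"
    have ratio: "loss_ratio q \<sigma> t = 1 + q * W"
      by (simp add: loss_ratio_def W_def algebra_simps)
    have "q * W > - 1"
      using loss_ratio_pos[of q \<sigma> t] assms unfolding ratio by simp
    moreover have "m + 2 - 1 = m + 1" "m + 2 - 2 = m" by simp_all
    ultimately have "(1 + q * W) powr (m + 2) \<le> 1 + (m + 2) * (q * W)
        + (m + 2) * (m + 1) / 2 * ((q * W)\<^sup>2 * max 1 ((1 + q * W) powr m))"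
      using one_plus_powr_le_quadratic[of "q * W" "m + 2"] assms(4) by (simp only:)
    then have "normal_density 0 \<sigma> t * loss_ratio q \<sigma> t powr (m + 2)
        \<le> normal_density 0 \<sigma> t * (1 + (m + 2) * (q * W)
        + (m + 2) * (m + 1) / 2 * ((q * W)\<^sup>2 * max 1 ((1 + q * W) powr m)))"
      unfolding ratio by (rule mult_left_mono) simp
    also have "\<dots> = normal_density 0 \<sigma> t + (m + 2) * q * (normal_density 1 \<sigma> t - normal_density 0 \<sigma> t)
        + K * (normal_density 0 \<sigma> t * (W\<^sup>2 * max 1 (loss_ratio q \<sigma> t powr m)))"
    proof -
      have "normal_density 1 \<sigma> t = normal_density 0 \<sigma> t * (1 + W)"
        using assms by (simp add: W_def normal_density_one_eq)
      moreover have "P * (1 + (m + 2) * (q * W) + (m + 2) * (m + 1) / 2 * ((q * W)\<^sup>2 * R))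
          = P + (m + 2) * q * (P * (1 + W) - P) + K * (P * (W\<^sup>2 * R))" for P R
        unfolding K_def by (simp add: power2_eq_square algebra_simps)
      ultimately show ?thesis
        by (simp only: ratio)
    qed
    also have "\<dots> \<le> B t"
      unfolding B_def W_def using assms K
      by (intro add_left_mono mult_left_mono second_order_le_majorant[where c = c]) auto
    finally show ?thesis .
  qed
  note maj = second_order_majorant_bochner[of \<sigma>]
  have B_int: "integrable lborel B"
    unfolding B_def[abs_def] using assms maj by auto
  have "(\<integral> t. B t \<partial>lborel) = 1 + K * (\<integral> t. second_order_majorant \<sigma> t \<partial>lborel)"
    unfolding B_def using assms maj by simp
  also have "\<dots> \<le> 1 + K * (4 / \<sigma>\<^sup>2)"
    using maj K assms by (intro add_left_mono mult_left_mono) auto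
  also have "\<dots> = 1 + 2 * q\<^sup>2 * (m + 2) * (m + 1) / \<sigma>\<^sup>2"
    by (simp add: K_def)
  finally have B_le: "(\<integral> t. B t \<partial>lborel) \<le> 1 + 2 * q\<^sup>2 * (m + 2) * (m + 1) / \<sigma>\<^sup>2" .
  \<comment> \<open>The difference of densities in \<open>B\<close> may be negative, so the sign of
    \<open>B\<close> is read off from the non-negative function it dominates.\<close>
  have "0 \<le> B t" for t
    using pointwise[of t] by (rule order_trans[rotated]) simp
  then have B_nn: "(\<integral>\<^sup>+ t. ennreal (B t) \<partial>lborel) = ennreal (\<integral> t. B t \<partial>lborel)"
    using B_int by (intro nn_integral_eq_integral) auto
  have "(\<integral>\<^sup>+ t. ennreal (normal_density 0 \<sigma> t * loss_ratio q \<sigma> t powr (m + 2)) \<partial>lborel)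
      \<le> (\<integral>\<^sup>+ t. ennreal (B t) \<partial>lborel)"
    by (intro nn_integral_mono ennreal_leI pointwise)
  also have "\<dots> \<le> ennreal (1 + 2 * q\<^sup>2 * (m + 2) * (m + 1) / \<sigma>\<^sup>2)"
    unfolding B_nn by (rule ennreal_leI[OF B_le])
  finally show ?thesis .
qed

theorem theorem8:
  fixes q \<sigma> L lam c :: real and k :: nat
  assumes "0 < q" and "q \<le> 1 / 5" and "\<sigma> \<ge> 4"
    and "lam = L / 2"
    and "c = ln (1 + 1 / (q * (lam - 1)))"
    and "1 < lam"
    and "lam \<le> 1 / 2 * \<sigma>\<^sup>2 * c - 2 * ln \<sigma>"
    and "lam \<le> (1 / 2 * \<sigma>\<^sup>2 * c - ln 5 - 2 * ln \<sigma>) / (c + ln (q * lam) + 1 / (2 * \<sigma>\<^sup>2))"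
    and "k \<ge> 1"
  shows "(\<integral>\<^sup>+ s \<in> {L..}. conv_power (\<lambda>x. ennreal (pld q \<sigma> x)) k s \<partial>lborel)
    \<le> ennreal ((1 + 2 * q\<^sup>2 * (L / 2 + 1) * (L / 2) / \<sigma>\<^sup>2) ^ k * exp (- L\<^sup>2 / 2))"
proof -
  have q: "q < 1" using assms(2) by simp
  have [measurable]: "pld q \<sigma> \<in> borel_measurable borel"
    using assms q by (intro borel_measurable_pld) auto
  define M where "M = 1 + 2 * q\<^sup>2 * (L / 2 + 1) * (L / 2) / \<sigma>\<^sup>2"
  have M: "M \<ge> 0"
    using assms by (auto simp: M_def intro!: add_nonneg_nonneg)
  \<comment> \<open>The case \<open>m = lam - 1\<close>: the \<open>c\<close> of the moment bound is
    then the given one, and the power \<open>m + 2 = lam + 1\<close> is the one that the change of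
    variables produces for the exponent \<open>lam\<close>.\<close>
  have "lam - 1 \<le> \<sigma>\<^sup>2 * c / 2"
  proof -
    have "ln \<sigma> \<ge> 0" using assms(3) by simp
    then show ?thesis using assms(7) by simp
  qed
  then have "(\<integral>\<^sup>+ t. ennreal (normal_density 0 \<sigma> t * loss_ratio q \<sigma> t powr (lam - 1 + 2)) \<partial>lborel)
      \<le> ennreal (1 + 2 * q\<^sup>2 * (lam - 1 + 2) * (lam - 1 + 1) / \<sigma>\<^sup>2)"
    using assms(6) by (intro nn_integral_loss_ratio_powr_le[OF assms(1) q assms(3) _ assms(5)]) auto
  moreover have "lam - 1 + 2 = lam + 1" by simp
  moreover have "1 + 2 * q\<^sup>2 * (lam - 1 + 2) * (lam - 1 + 1) / \<sigma>\<^sup>2 = M"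
    by (simp add: M_def assms(4) add.commute)
  ultimately have "(\<integral>\<^sup>+ t. ennreal (normal_density 0 \<sigma> t * loss_ratio q \<sigma> t powr (lam + 1)) \<partial>lborel) \<le> ennreal M"
    by (simp only:)
  then have moment: "(\<integral>\<^sup>+ s. ennreal (pld q \<sigma> s) * ennreal (exp (lam * s)) \<partial>lborel) \<le> ennreal M"
    using nn_integral_pld_exp_le[of q \<sigma> lam] assms q by (auto intro: order_trans)
  \<comment> \<open>The Chernoff exponent \<open>lam = L / 2\<close> turns
    \<open>exp (- (lam * L))\<close> into the claimed Gaussian tail factor.\<close>
  have "(\<integral>\<^sup>+ s \<in> {L..}. conv_power (\<lambda>x. ennreal (pld q \<sigma> x)) k s \<partial>lborel)
      \<le> (\<integral>\<^sup>+ s. conv_power (\<lambda>x. ennreal (pld q \<sigma> x)) k s * ennreal (exp (lam * s)) \<partial>lborel)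
        * ennreal (exp (- (lam * L)))"
    using assms by (intro nn_integral_chernoff) auto
  also have "\<dots> = (\<integral>\<^sup>+ s. ennreal (pld q \<sigma> s) * ennreal (exp (lam * s)) \<partial>lborel) ^ k
        * ennreal (exp (- (lam * L)))"
    using assms(9) by (subst nn_integral_conv_power_exp) auto
  also have "\<dots> \<le> ennreal M ^ k * ennreal (exp (- (lam * L)))"
    using moment by (intro mult_right_mono power_mono) auto
  also have "\<dots> = ennreal (M ^ k * exp (- L\<^sup>2 / 2))"
  proof -
    have "- (lam * L) = - L\<^sup>2 / 2"
      using assms(4) by (simp add: power2_eq_square)
    then show ?thesis
      using M by (simp only: ennreal_mult ennreal_power zero_le_power exp_ge_zero)
  qed
  finally show ?thesis
    unfolding M_def .
qed

end
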